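(* Let $y_0\in Y$. The optimal value $\mu_N^*(y_0)$ of the $N$-approximating problem converges to the optimal value $\mu^*(y_0)$ of the max-min problem as $N\to\infty$: $$\lim_{N\to\infty}\mu_N^*(y_0)=\mu^*(y_0).$$
   Context: Setting: $Y\subset\mathbb{R}^m$ is nonempty and compact, $U_0$ is a compact metric space, $U(\cdot)$ is an upper semicontinuous compact-valued set-valued map from $Y$ to $U_0$, $f:\mathbb{R}^m\times U_0\to\mathbb{R}^m$ and $g:\mathbb{R}^m\times U_0\to\mathbb{R}$ are continuous, and $\alpha\in(0,1)$. Put $A(y):=\{u\in U(y): f(y,u)\in Y\}$ for $y\in Y$ and $G:=\{(y,u): y\in Y,\ u\in A(y)\}$ (a compact set). Standing assumption: $A(y)\neq\emptyset$ for every $y\in Y$. For a bounded lower semicontinuous $\psi:Y\to\mathbb{R}$ let $H_\psi(y):=\min_{u\in A(y)}\{g(y,u)+\alpha(\psi(f(y,u))-\psi(y))\}$, $y\in Y$. The max-min problem has optimal value $$\mu^*(y_0):=\max_{\psi}\ \inf_{y\in Y}\{H_\psi(y)-(1-\alpha)(\psi(y)-\psi(y_0))\},$$ over all bounded lower semicontinuous $\psi:Y\to\mathbb{R}$. Let $\{\phi_i\}_{i=1}^\infty$ be a sequence of continuous real-valued functions on $Y$ with $\phi_1\equiv1$ such that: (i) any finite collection of functions from the sequence is linearly independent on any nonempty open set (open subset of $\mathbb{R}^m$ contained in $Y$); (ii) for any $\psi\in C(Y)$ and $\delta>0$ there exist $N$ and real $\lambda_1,\dots,\lambda_N$ with $\max_{y\in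 Y}|\psi(y)-\sum_{i=1}^N\lambda_i\phi_i(y)|\le\delta$. Let $D_N:=\{\sum_{i=1}^N\lambda_i\phi_i:\lambda_i\in\mathbb{R}\}\subset C(Y)$. The $N$-approximating problem has optimal value $$\mu_N^*(y_0):=\sup_{\psi\in D_N}\min_{(y,u)\in G}\{g(y,u)+\alpha(\psi(f(y,u))-\psi(y))+(1-\alpha)(\psi(y_0)-\psi(y))\}.$$ *)

theory Defs
  imports "HOL-Analysis.Analysis"
begin

definition usc_set_valued_on ::
  "'a::topological_space set \<Rightarrow> ('a \<Rightarrow> 'b::topological_space set) \<Rightarrow> bool" where
  "usc_set_valued_on Y U \<longleftrightarrow>
     (\<forall>y\<in>Y. \<forall>V. open V \<and> U y \<subseteq> V \<longrightarrow> (\<forall>\<^sub>F z in at y within Y. U z \<subseteq> V))"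

definition lsc_on :: "'a::topological_space set \<Rightarrow> ('a \<Rightarrow> real) \<Rightarrow> bool" where
  "lsc_on Y \<psi> \<longleftrightarrow> (\<forall>y\<in>Y. \<forall>a<\<psi> y. \<forall>\<^sub>F z in at y within Y. a < \<psi> z)"

(* Throughout, real-valued functions on Y are represented by total functions of which
   only the values on Y are used. *)

definition admissible :: "'a set \<Rightarrow> ('a \<Rightarrow> 'u set) \<Rightarrow> ('a \<Rightarrow> 'u \<Rightarrow> 'a) \<Rightarrow> 'a \<Rightarrow> 'u set" where
  "admissible Y U f y = {u \<in> U y. f y u \<in> Y}"

definition admissible_graph :: "'a set \<Rightarrow> ('a \<Rightarrow> 'u set) \<Rightarrow> ('a \<Rightarrow> 'u \<Rightarrow> 'a) \<Rightarrow> ('a \<times> 'u) set" where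
  "admissible_graph Y U f = {(y, u). y \<in> Y \<and> u \<in> admissible Y U f y}"

(* LEAST / GREATEST (minimum / maximum, i.e. an attained bound) render min / max;
   INF / SUP render inf / sup. *)

definition hamiltonian ::
  "'a set \<Rightarrow> ('a \<Rightarrow> 'u set) \<Rightarrow> ('a \<Rightarrow> 'u \<Rightarrow> 'a) \<Rightarrow> ('a \<Rightarrow> 'u \<Rightarrow> real) \<Rightarrow> real \<Rightarrow>
   ('a \<Rightarrow> real) \<Rightarrow> 'a \<Rightarrow> real" where
  "hamiltonian Y U f g \<alpha> \<psi> y =
     (LEAST v. v \<in> (\<lambda>u. g y u + \<alpha> * (\<psi> (f y u) - \<psi> y)) ` admissible Y U f y)"

definition maxmin_value ::
  "'a::topological_space set \<Rightarrow> ('a \<Rightarrow> 'u set) \<Rightarrow> ('a \<Rightarrow> 'u \<Rightarrow> 'a) \<Rightarrow> ('a \<Rightarrow> 'u \<Rightarrow> real) \<Rightarrow>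
   real \<Rightarrow> 'a \<Rightarrow> real" where
  "maxmin_value Y U f g \<alpha> y\<^sub>0 =
     (GREATEST v. v \<in> (\<lambda>\<psi>. INF y\<in>Y. hamiltonian Y U f g \<alpha> \<psi> y - (1 - \<alpha>) * (\<psi> y - \<psi> y\<^sub>0))
                        ` {\<psi>. bounded (\<psi> ` Y) \<and> lsc_on Y \<psi>})"

definition linear_combinations :: "(nat \<Rightarrow> 'a \<Rightarrow> real) \<Rightarrow> nat \<Rightarrow> ('a \<Rightarrow> real) set" where
  "linear_combinations \<phi> N = {(\<lambda>y. \<Sum>i=1..N. c i * \<phi> i y) | c. True}"

definition approx_value ::
  "'a set \<Rightarrow> ('a \<Rightarrow> 'u set) \<Rightarrow> ('a \<Rightarrow> 'u \<Rightarrow> 'a) \<Rightarrow> ('a \<Rightarrow> 'u \<Rightarrow> real) \<Rightarrow> real \<Rightarrow>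
   (nat \<Rightarrow> 'a \<Rightarrow> real) \<Rightarrow> nat \<Rightarrow> 'a \<Rightarrow> real" where
  "approx_value Y U f g \<alpha> \<phi> N y\<^sub>0 =
     (SUP \<psi>\<in>linear_combinations \<phi> N.
        LEAST v. v \<in> (\<lambda>(y, u). g y u + \<alpha> * (\<psi> (f y u) - \<psi> y) + (1 - \<alpha>) * (\<psi> y\<^sub>0 - \<psi> y))
                       ` admissible_graph Y U f)"

definition linearly_independent_on ::
  "'a set \<Rightarrow> nat set \<Rightarrow> (nat \<Rightarrow> 'a \<Rightarrow> real) \<Rightarrow> bool" where
  "linearly_independent_on S I \<phi> \<longleftrightarrow>
     (\<forall>c. (\<forall>y\<in>S. (\<Sum>i\<in>I. c i * \<phi> i y) = 0) \<longrightarrow> (\<forall>i\<in>I. c i = 0))"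

end

theory Submission
  imports Defs
begin

text \<open>
  Let \<open>W\<close> be the pointwise supremum of all continuous \<open>w\<close> with \<open>w y \<le> g y u + \<alpha> * w (f y u)\<close> on the
  graph \<open>G\<close>. These subsolutions are directed under \<open>max\<close>, and raising one of them by a continuous
  minorant of \<open>\<lambda>y. min\<^sub>u (g y u + \<alpha> * w (f y u))\<close> again gives a subsolution; together with compactness
  of the admissible sets this makes \<open>W\<close> a lower semicontinuous solution of the Bellman equation
  \<open>W y = min\<^sub>u (g y u + \<alpha> * W (f y u))\<close>. By comparison both problems are bounded above by
  \<open>(1 - \<alpha>) * W y\<^sub>0\<close>, and \<open>\<psi> = W\<close> attains this bound in the max-min problem. Since \<open>W y\<^sub>0\<close> is a
  supremum over continuous functions, which \<open>D\<^sub>N\<close> approximates uniformly, the values of the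
  \<open>N\<close>-approximating problems tend to the same number.
\<close>

section \<open>Minima on compact sets, semicontinuity along sequences, spans\<close>

lemma closed_sublevels_attain_min:
  fixes q :: "'a::topological_space \<Rightarrow> real"
  assumes "compact K" "K \<noteq> {}" and cl: "\<And>a. closed {x\<in>K. q x \<le> a}"
  shows "\<exists>x\<in>K. \<forall>t\<in>K. q x \<le> q t"
proof -
  \<comment> \<open>A common point of all sublevel sets \<open>q x \<le> q t\<close> is a minimiser.
    Any finite number of them meet, at the index with the smallest value, so compactness
    applies.\<close>
  have "K \<inter> \<Inter>((\<lambda>t. {x\<in>K. q x \<le> q t}) ` K) \<noteq> {}"
  proof (rule compact_imp_fip_image[OF assms(1)])
    show "closed {x\<in>K. q x \<le> q t}" if "t \<in> K" for t by (rule cl)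
    fix I' assume I': "finite I'" "I' \<subseteq> K"
    show "K \<inter> (\<Inter>t\<in>I'. {x\<in>K. q x \<le> q t}) \<noteq> {}"
    proof (cases "I' = {}")
      case True then show ?thesis using assms(2) by auto
    next
      case False
      then have "Min (q ` I') \<in> q ` I'" using I' by (intro Min_in) auto
      then obtain x where x: "x \<in> I'" "q x = Min (q ` I')" by auto
      then have "\<forall>t\<in>I'. q x \<le> q t" using I' by simp
      then show ?thesis using x(1) I'(2) by auto
    qed
  qed
  then show ?thesis by blast
qed

text \<open>The filter in \<open>lsc_on\<close> is punctured, but at \<open>l\<close> itself the
  inequality is the assumption \<open>a < \<psi> l\<close>. It therefore holds on a full
  neighbourhood relative to \<open>Y\<close>, and the sequence may hit its limit.\<close>

lemma lsc_on_sequentially: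
  assumes "lsc_on Y \<psi>" "\<And>n. x n \<in> Y" "l \<in> Y" "x \<longlonglongrightarrow> l" "a < \<psi> l"
  shows "\<forall>\<^sub>F n in sequentially. a < \<psi> (x n)"
proof -
  have "\<forall>\<^sub>F z in at l within Y. a < \<psi> z" using assms unfolding lsc_on_def by blast
  then have "\<forall>\<^sub>F z in nhds l. z \<in> Y \<longrightarrow> a < \<psi> z"
    using assms(5) unfolding eventually_at_filter by (auto elim: eventually_mono)
  then have "\<forall>\<^sub>F n in sequentially. x n \<in> Y \<longrightarrow> a < \<psi> (x n)"
    using assms(4) by (rule eventually_compose_filterlim)
  then show ?thesis using assms(2) by simp
qed

lemma Least_attained:
  fixes q :: "'a \<Rightarrow> 'b::order"
  assumes "x \<in> K" "\<And>t. t \<in> K \<Longrightarrow> q x \<le> q t"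
  shows "(LEAST v. v \<in> q ` K) = q x"
  by (rule Least_equality) (use assms in auto)

text \<open>Padding with zero coefficients. Thanks to nesting, an approximant found for one
  \<open>N\<close> serves all larger ones.\<close>

lemma linear_combinations_mono:
  assumes "N \<le> N'"
  shows "linear_combinations \<phi> N \<subseteq> linear_combinations \<phi> N'"
proof
  fix \<psi> assume "\<psi> \<in> linear_combinations \<phi> N"
  then obtain c where c: "\<psi> = (\<lambda>y. \<Sum>i=1..N. c i * \<phi> i y)"
    unfolding linear_combinations_def by blast
  have "\<psi> y = (\<Sum>i=1..N'. (if i \<le> N then c i else 0) * \<phi> i y)" for y
    unfolding c using assms by (intro sum.mono_neutral_cong_left) auto
  then show "\<psi> \<in> linear_combinations \<phi> N'"
    unfolding linear_combinations_def mem_Collect_eq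
    by (intro exI[of _ "\<lambda>i. if i \<le> N then c i else 0"] conjI ext TrueI)
qed

lemma admissible_graph_eq: "admissible_graph Y U f = Sigma Y (admissible Y U f)"
  by (auto simp: admissible_graph_def)

text \<open>The graph lies in the compact product of \<open>Y\<close> and \<open>U\<^sub>0\<close>,
  so closedness suffices. The constraint \<open>u \<in> U y\<close> survives limits because an upper
  semicontinuous map with closed values has a closed graph; \<open>f y u \<in> Y\<close> survives
  because \<open>f\<close> is continuous and \<open>Y\<close> closed.\<close>

lemma compact_admissible_graph:
  fixes Y :: "'a::metric_space set" and U :: "'a \<Rightarrow> 'u::metric_space set"
  assumes Y: "compact Y" and U0: "compact U\<^sub>0" and sub: "\<And>y. y \<in> Y \<Longrightarrow> U y \<subseteq> U\<^sub>0"
    and cU: "\<And>y. y \<in> Y \<Longrightarrow> compact (U y)" and usc: "usc_set_valued_on Y U"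
    and f: "continuous_on (Y \<times> U\<^sub>0) (\<lambda>(y, u). f y u)"
  shows "compact (admissible_graph Y U f)"
proof -
  have "closed (admissible_graph Y U f)"
    unfolding closed_sequential_limits
  proof (intro allI impI, elim conjE)
    fix x :: "nat \<Rightarrow> 'a \<times> 'u" and l
    assume x: "\<forall>n. x n \<in> admissible_graph Y U f" and lim: "x \<longlonglongrightarrow> l"
    obtain y u where l: "l = (y, u)" by (cases l)
    have xn: "fst (x n) \<in> Y" "snd (x n) \<in> U (fst (x n))" "f (fst (x n)) (snd (x n)) \<in> Y" for n
      using x[rule_format, of n] by (auto simp: admissible_graph_def admissible_def)
    have limy: "(\<lambda>n. fst (x n)) \<longlonglongrightarrow> y" and limu: "(\<lambda>n. snd (x n)) \<longlonglongrightarrow> u"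
      using tendsto_fst[OF lim] tendsto_snd[OF lim] by (simp_all add: l)
    have y: "y \<in> Y"
      by (rule closed_sequentially[OF compact_imp_closed[OF Y] _ limy]) (rule xn)
    have u0: "u \<in> U\<^sub>0"
      by (rule closed_sequentially[OF compact_imp_closed[OF U0] _ limu]) (use xn sub in blast)
    have u: "u \<in> U y"
    proof (rule ccontr)
      assume "u \<notin> U y"
      then obtain e where e: "e > 0" "ball u e \<subseteq> - U y"
        using open_Compl[OF compact_imp_closed[OF cU[OF y]]] by (meson ComplI openE)
      \<comment> \<open>Halving the radius gives an open set that contains \<open>U y\<close> yet
        stays at distance at least \<open>e / 2\<close> from \<open>u\<close>, so the controls in
        \<open>U (fst (x n))\<close> cannot converge to \<open>u\<close>.\<close>
      define V where "V = - cball u (e / 2)"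
      have V: "open V" "U y \<subseteq> V" using e by (force simp: V_def)+
      then have "\<forall>\<^sub>F z in at y within Y. U z \<subseteq> V"
        using usc y unfolding usc_set_valued_on_def by blast
      then have "\<forall>\<^sub>F z in nhds y. z \<in> Y \<longrightarrow> U z \<subseteq> V"
        using V(2) unfolding eventually_at_filter by (auto elim: eventually_mono)
      then have "\<forall>\<^sub>F n in sequentially. fst (x n) \<in> Y \<longrightarrow> U (fst (x n)) \<subseteq> V"
        using limy by (rule eventually_compose_filterlim)
      moreover have "\<forall>\<^sub>F n in sequentially. dist (snd (x n)) u < e / 2"
        using limu e(1) by (intro tendstoD) auto
      ultimately have "\<forall>\<^sub>F n in sequentially. False"
        by eventually_elim (use xn in \<open>fastforce simp: V_def dist_commute\<close>)
      then show False by simp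
    qed
    have "(\<lambda>n. (\<lambda>(y, u). f y u) (x n)) \<longlonglongrightarrow> (\<lambda>(y, u). f y u) l"
      by (rule continuous_on_tendsto_compose[OF f lim])
        (use y u0 xn(1) subsetD[OF sub[OF xn(1)] xn(2)] in \<open>auto simp: l mem_Times_iff\<close>)
    then have "(\<lambda>n. f (fst (x n)) (snd (x n))) \<longlonglongrightarrow> f y u" by (simp add: l case_prod_unfold)
    then have "f y u \<in> Y"
      by (rule closed_sequentially[OF compact_imp_closed[OF Y] xn(3)])
    then show "l \<in> admissible_graph Y U f"
      using y u by (auto simp: l admissible_graph_def admissible_def)
  qed
  moreover have "admissible_graph Y U f = (Y \<times> U\<^sub>0) \<inter> admissible_graph Y U f"
    using sub by (auto simp: admissible_graph_def admissible_def)
  ultimately show ?thesis using compact_Int_closed[OF compact_Times[OF Y U0]] by metis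
qed

section \<open>The discounted problem, stated through the admissible map alone\<close>

locale discounted_control =
  fixes Y :: "'a::metric_space set" and A :: "'a \<Rightarrow> 'u::metric_space set"
    and f :: "'a \<Rightarrow> 'u \<Rightarrow> 'a" and g :: "'a \<Rightarrow> 'u \<Rightarrow> real" and \<alpha> :: real
  assumes compact_graph: "compact (Sigma Y A)"
    and A_nonempty: "y \<in> Y \<Longrightarrow> A y \<noteq> {}"
    and f_in: "y \<in> Y \<Longrightarrow> u \<in> A y \<Longrightarrow> f y u \<in> Y"
    and continuous_f: "continuous_on (Sigma Y A) (\<lambda>(y, u). f y u)"
    and continuous_g: "continuous_on (Sigma Y A) (\<lambda>(y, u). g y u)"
    and alpha_pos: "0 < \<alpha>" and alpha_less_1: "\<alpha> < 1"
begin

text \<open>Quantifying over all \<open>u\<close> expresses the Bellman inequality with a minimum on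
  the right, without having to form that minimum.\<close>

definition subsolutions :: "('a \<Rightarrow> real) set" where
  "subsolutions = {w. continuous_on Y w \<and> (\<forall>y\<in>Y. \<forall>u\<in>A y. w y \<le> g y u + \<alpha> * w (f y u))}"

text \<open>This is the function \<open>W\<close> of the introduction. The real-valued supremum is
  meaningful on \<open>Y\<close>, where the family is nonempty and bounded above by the lemmas
  below.\<close>

definition bellman :: "'a \<Rightarrow> real" where
  "bellman y = (SUP w\<in>subsolutions. w y)"

section \<open>Compactness and continuity on the graph and its sections\<close>

lemma compact_Y: "compact Y"
proof -
  have "fst ` Sigma Y A = Y" using A_nonempty by force
  then show ?thesis
    using compact_continuous_image[OF continuous_on_fst[OF continuous_on_id] compact_graph] by simp
qed

lemma compact_A:
  assumes "y \<in> Y" shows "compact (A y)"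
proof -
  have "compact (Sigma Y A \<inter> {y} \<times> UNIV)"
    by (intro compact_Int_closed compact_graph closed_Times) auto
  moreover have "snd ` (Sigma Y A \<inter> {y} \<times> UNIV) = A y" using assms by force
  ultimately show ?thesis
    using compact_continuous_image[OF continuous_on_snd[OF continuous_on_id]] by metis
qed

lemma continuous_on_section:
  assumes "continuous_on (Sigma Y A) (\<lambda>(y, u). h y u)" "y \<in> Y"
  shows "continuous_on (A y) (h y)"
proof -
  have "continuous_on (A y) (\<lambda>u. (\<lambda>(y, u). h y u) (y, u))"
    by (rule continuous_on_compose2[OF assms(1) continuous_on_Pair[OF continuous_on_const continuous_on_id]])
      (use assms(2) in auto)
  then show ?thesis by simp
qed

lemma continuous_on_graph:
  assumes "continuous_on Y w"
  shows "continuous_on (Sigma Y A) (\<lambda>(y, u). w (f y u))"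
proof -
  have "continuous_on (Sigma Y A) (\<lambda>p. w ((\<lambda>(y, u). f y u) p))"
    by (rule continuous_on_compose2[OF assms continuous_f]) (use f_in in auto)
  then show ?thesis by (simp add: case_prod_unfold)
qed

lemma continuous_on_graph_fst:
  assumes "continuous_on Y w"
  shows "continuous_on (Sigma Y A) (\<lambda>(y, u). w y)"
proof -
  have "continuous_on (Sigma Y A) (\<lambda>p. w (fst p))"
    by (rule continuous_on_compose2[OF assms continuous_on_fst[OF continuous_on_id]]) auto
  then show ?thesis by (simp add: case_prod_unfold)
qed

lemma continuous_bellman_rhs:
  assumes "continuous_on Y w"
  shows "continuous_on (Sigma Y A) (\<lambda>(y, u). g y u + \<alpha> * w (f y u))"
  using continuous_g continuous_on_graph[OF assms]
  by (auto simp: case_prod_unfold intro!: continuous_intros)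

lemma continuous_bellman_rhs_section:
  assumes "continuous_on Y w" "y \<in> Y"
  shows "continuous_on (A y) (\<lambda>u. g y u + \<alpha> * w (f y u))"
  by (rule continuous_on_section[OF continuous_bellman_rhs[OF assms(1)] assms(2)])

section \<open>Bounds and lower semicontinuity of the supremum of subsolutions\<close>

lemma g_bounded: "\<exists>M. \<forall>y\<in>Y. \<forall>u\<in>A y. \<bar>g y u\<bar> \<le> M"
proof -
  have "bounded ((\<lambda>(y, u). g y u) ` Sigma Y A)"
    by (intro compact_imp_bounded compact_continuous_image continuous_g compact_graph)
  then obtain M where "\<forall>v\<in>(\<lambda>(y, u). g y u) ` Sigma Y A. \<bar>v\<bar> \<le> M"
    unfolding bounded_iff by auto
  then show ?thesis by (intro exI[of _ M]) auto
qed

text \<open>At a maximum point \<open>z\<close> of \<open>w\<close> the successor value is at most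
  \<open>w z\<close>, so the inequality closes up to
  \<open>w z \<le> M + \<alpha> * w z\<close>.\<close>

lemma subsolution_le:
  assumes M: "\<And>y u. y \<in> Y \<Longrightarrow> u \<in> A y \<Longrightarrow> \<bar>g y u\<bar> \<le> M"
    and w: "w \<in> subsolutions" and y: "y \<in> Y"
  shows "w y \<le> M / (1 - \<alpha>)"
proof -
  have "continuous_on Y w" using w by (simp add: subsolutions_def)
  then obtain z where z: "z \<in> Y" "\<forall>x\<in>Y. w x \<le> w z"
    using continuous_attains_sup[OF compact_Y] y by blast
  obtain u where u: "u \<in> A z" using A_nonempty z by blast
  have "w z \<le> g z u + \<alpha> * w (f z u)" using w z u by (simp add: subsolutions_def)
  also have "\<dots> \<le> M + \<alpha> * w z"
    using M[OF z(1) u] z f_in[OF z(1) u] alpha_pos by (intro add_mono mult_left_mono) auto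
  finally have "w z * (1 - \<alpha>) \<le> M" by (simp add: algebra_simps)
  then have "w z \<le> M / (1 - \<alpha>)" using alpha_less_1 by (simp add: pos_le_divide_eq)
  then show ?thesis using z y by force
qed

text \<open>The constant is the fixed point of \<open>c = - M + \<alpha> * c\<close>, the Bellman
  equation for the worst running cost \<open>- M\<close>.\<close>

lemma const_subsolution:
  assumes M: "\<And>y u. y \<in> Y \<Longrightarrow> u \<in> A y \<Longrightarrow> \<bar>g y u\<bar> \<le> M"
  shows "(\<lambda>_. - M / (1 - \<alpha>)) \<in> subsolutions"
proof -
  have "- M / (1 - \<alpha>) = - M + \<alpha> * (- M / (1 - \<alpha>))"
    using alpha_less_1 by (simp add: field_simps)
  moreover have "- M \<le> g y u" if "y \<in> Y" "u \<in> A y" for y u using M[OF that] by linarith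
  ultimately have "- M / (1 - \<alpha>) \<le> g y u + \<alpha> * (- M / (1 - \<alpha>))" if "y \<in> Y" "u \<in> A y" for y u
    using that by (metis add_right_mono)
  then show ?thesis by (simp add: subsolutions_def)
qed

lemma subsolutions_nonempty: "subsolutions \<noteq> {}"
proof -
  obtain M where "\<And>y u. y \<in> Y \<Longrightarrow> u \<in> A y \<Longrightarrow> \<bar>g y u\<bar> \<le> M" using g_bounded by blast
  from const_subsolution[OF this] show ?thesis by blast
qed

lemma bdd_above_subsolutions: "y \<in> Y \<Longrightarrow> bdd_above ((\<lambda>w. w y) ` subsolutions)"
proof -
  assume y: "y \<in> Y"
  obtain M where "\<And>y u. y \<in> Y \<Longrightarrow> u \<in> A y \<Longrightarrow> \<bar>g y u\<bar> \<le> M" using g_bounded by blast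
  from subsolution_le[OF this _ y] show ?thesis by (rule bdd_above.I2)
qed

lemma subsolution_le_bellman: "w \<in> subsolutions \<Longrightarrow> y \<in> Y \<Longrightarrow> w y \<le> bellman y"
  unfolding bellman_def by (rule cSUP_upper) (use bdd_above_subsolutions in auto)

lemma less_bellmanD:
  assumes "a < bellman y" "y \<in> Y"
  obtains w where "w \<in> subsolutions" "a < w y"
  using less_cSUP_iff[OF subsolutions_nonempty bdd_above_subsolutions[OF assms(2)], THEN iffD1,
      OF assms(1)[unfolded bellman_def]] that by blast

lemma bounded_bellman: "bounded (bellman ` Y)"
proof -
  obtain M where M: "\<And>y u. y \<in> Y \<Longrightarrow> u \<in> A y \<Longrightarrow> \<bar>g y u\<bar> \<le> M" using g_bounded by blast
  have "\<bar>bellman y\<bar> \<le> M / (1 - \<alpha>)" if "y \<in> Y" for y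
  proof -
    have "bellman y \<le> M / (1 - \<alpha>)"
      unfolding bellman_def using subsolution_le[OF M] that subsolutions_nonempty
      by (intro cSUP_least) auto
    moreover have "- M / (1 - \<alpha>) \<le> bellman y"
      using subsolution_le_bellman[OF const_subsolution[OF M] that] .
    ultimately show ?thesis by (simp add: abs_le_iff)
  qed
  then show ?thesis unfolding bounded_iff by auto
qed

lemma lsc_bellman: "lsc_on Y bellman"
  unfolding lsc_on_def
proof (intro ballI allI impI)
  fix y a assume y: "y \<in> Y" and "a < bellman y"
  then obtain w where w: "w \<in> subsolutions" "a < w y" using less_bellmanD by blast
  then have "(w \<longlongrightarrow> w y) (at y within Y)"
    using y by (auto simp: subsolutions_def continuous_on_def)
  then have "\<forall>\<^sub>F z in at y within Y. a < w z" using w(2) by (rule order_tendstoD)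
  moreover have "\<forall>\<^sub>F z in at y within Y. z \<in> Y" by (simp add: eventually_at_filter)
  ultimately show "\<forall>\<^sub>F z in at y within Y. a < bellman z"
    by eventually_elim (use subsolution_le_bellman[OF w(1)] in force)
qed

section \<open>The Bellman equation and comparison\<close>

lemma bellman_le:
  assumes "y \<in> Y" "u \<in> A y"
  shows "bellman y \<le> g y u + \<alpha> * bellman (f y u)"
  unfolding bellman_def[of y]
proof (rule cSUP_least[OF subsolutions_nonempty])
  fix w assume w: "w \<in> subsolutions"
  then have "w y \<le> g y u + \<alpha> * w (f y u)" using assms by (simp add: subsolutions_def)
  also have "\<dots> \<le> g y u + \<alpha> * bellman (f y u)"
    using subsolution_le_bellman[OF w f_in[OF assms]] alpha_pos by simp
  finally show "w y \<le> g y u + \<alpha> * bellman (f y u)" .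
qed

text \<open>The hypothesis on \<open>v\<close> has the maximum on its right-hand side, so
  \<open>v\<close> need not be a subsolution. This covers both the maximum of two subsolutions and
  the raising of \<open>w\<close> by a minorant of its Bellman right-hand side.\<close>

lemma max_subsolution:
  assumes v: "continuous_on Y v"
      "\<And>y u. y \<in> Y \<Longrightarrow> u \<in> A y \<Longrightarrow> v y \<le> g y u + \<alpha> * max (v (f y u)) (w (f y u))"
    and w: "w \<in> subsolutions"
  shows "(\<lambda>y. max (v y) (w y)) \<in> subsolutions"
  unfolding subsolutions_def
proof (intro CollectI conjI ballI)
  show "continuous_on Y (\<lambda>y. max (v y) (w y))"
    using v w by (intro continuous_on_max) (auto simp: subsolutions_def)
  fix y u assume yu: "y \<in> Y" "u \<in> A y"
  have "w y \<le> g y u + \<alpha> * w (f y u)" using w yu by (simp add: subsolutions_def)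
  moreover have "\<alpha> * w (f y u) \<le> \<alpha> * max (v (f y u)) (w (f y u))" using alpha_pos by simp
  ultimately show "max (v y) (w y) \<le> g y u + \<alpha> * max (v (f y u)) (w (f y u))"
    using v(2)[OF yu] by linarith
qed

lemma subsolutions_directed:
  assumes v: "v \<in> subsolutions" and w: "w \<in> subsolutions"
  shows "(\<lambda>y. max (v y) (w y)) \<in> subsolutions"
proof (rule max_subsolution[OF _ _ w])
  show "continuous_on Y v" using v by (simp add: subsolutions_def)
  fix y u assume "y \<in> Y" "u \<in> A y"
  then have "v y \<le> g y u + \<alpha> * v (f y u)" using v by (simp add: subsolutions_def)
  also have "\<dots> \<le> g y u + \<alpha> * max (v (f y u)) (w (f y u))" using alpha_pos by simp
  finally show "v y \<le> g y u + \<alpha> * max (v (f y u)) (w (f y u))" .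
qed

text \<open>Directedness in the form required by the finite intersection argument in
  \<open>bellman_ge\<close>.\<close>

lemma subsolutions_finite_upper_bound:
  assumes "finite F" "F \<subseteq> subsolutions"
  shows "\<exists>w\<in>subsolutions. \<forall>v\<in>F. \<forall>y. v y \<le> w y"
  using assms
proof (induction F)
  case empty
  then show ?case using subsolutions_nonempty by blast
next
  case (insert v F)
  then obtain w where "w \<in> subsolutions" "\<forall>v\<in>F. \<forall>y. v y \<le> w y" by blast
  then show ?case
    using insert.prems subsolutions_directed[of v w]
    by (intro bexI[of _ "\<lambda>y. max (v y) (w y)"]) (auto simp: le_max_iff_disj)
qed

text \<open>A downward cone with apex value \<open>c\<close> at \<open>y\<close> works: states where
  the right-hand side drops to \<open>c\<close> or below keep a positive distance from
  \<open>y\<close>, and there the cone is already below every value of the right-hand side.\<close>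

lemma continuous_minorant:
  assumes w: "continuous_on Y w" and y: "y \<in> Y"
    and c: "\<And>u. u \<in> A y \<Longrightarrow> c < g y u + \<alpha> * w (f y u)"
  obtains v where "continuous_on Y v" "v y = c"
    "\<And>z u. z \<in> Y \<Longrightarrow> u \<in> A z \<Longrightarrow> v z \<le> g z u + \<alpha> * w (f z u)"
proof -
  define h where "h = (\<lambda>(z, u). g z u + \<alpha> * w (f z u))"
  have h: "continuous_on (Sigma Y A) h" unfolding h_def by (rule continuous_bellman_rhs[OF w])
  have "bounded (h ` Sigma Y A)"
    by (intro compact_imp_bounded compact_continuous_image h compact_graph)
  then obtain M where M: "\<And>p. p \<in> Sigma Y A \<Longrightarrow> \<bar>h p\<bar> \<le> M" unfolding bounded_iff by auto
  \<comment> \<open>The states where some control makes \<open>h\<close> at most \<open>c\<close>.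
    As a projection of a compact set \<open>P\<close> is closed, and by the choice of
    \<open>c\<close> it misses \<open>y\<close>.\<close>
  define P where "P = fst ` {p \<in> Sigma Y A. h p \<le> c}"
  have "closed {p \<in> Sigma Y A. h p \<le> c}"
    by (intro continuous_on_closed_Collect_le h continuous_on_const
        compact_imp_closed compact_graph)
  then have "compact (Sigma Y A \<inter> {p \<in> Sigma Y A. h p \<le> c})"
    by (rule compact_Int_closed[OF compact_graph])
  also have "Sigma Y A \<inter> {p \<in> Sigma Y A. h p \<le> c} = {p \<in> Sigma Y A. h p \<le> c}" by blast
  finally have "closed P"
    unfolding P_def
    by (intro compact_imp_closed compact_continuous_image continuous_on_fst continuous_on_id)
  moreover have "y \<notin> P" using c by (force simp: P_def h_def)
  ultimately obtain d where d: "d > 0" "ball y d \<subseteq> - P"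
    using open_Compl by (meson ComplI openE)
  \<comment> \<open>With this slope the cone has fallen by \<bar>c + M\<bar> at distance
    \<open>d\<close>, hence to \<open>- M\<close> or lower.\<close>
  define k where "k = \<bar>c + M\<bar> / d"
  define v where "v = (\<lambda>z. c - k * dist y z)"
  show ?thesis
  proof
    show "continuous_on Y v" unfolding v_def by (intro continuous_intros)
    show "v y = c" by (simp add: v_def)
    fix z u assume zu: "z \<in> Y" "u \<in> A z"
    have "k \<ge> 0" using d by (simp add: k_def)
    show "v z \<le> g z u + \<alpha> * w (f z u)"
    proof (cases "h (z, u) \<le> c")
      case False
      moreover have "v z \<le> c" using \<open>k \<ge> 0\<close> by (simp add: v_def)
      ultimately show ?thesis by (simp add: h_def)
    next
      case True
      then have "z \<in> P" using zu by (force simp: P_def)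
      then have "k * d \<le> k * dist y z" using d \<open>k \<ge> 0\<close> by (intro mult_left_mono) force+
      moreover have "k * d = \<bar>c + M\<bar>" using d by (simp add: k_def)
      ultimately have "v z \<le> - M" by (simp add: v_def)
      also have "\<dots> \<le> h (z, u)" using M[of "(z, u)"] zu by (simp add: abs_le_iff)
      finally show ?thesis by (simp add: h_def)
    qed
  qed
qed

text \<open>Otherwise the minimum over controls strictly exceeds \<open>bellman y\<close>, and a
  minorant with a value strictly in between at \<open>y\<close> would raise \<open>w\<close> to a
  subsolution larger than \<open>bellman\<close> there.\<close>

lemma bellman_ge_subsolution_step:
  assumes w: "w \<in> subsolutions" and y: "y \<in> Y"
  shows "\<exists>u\<in>A y. g y u + \<alpha> * w (f y u) \<le> bellman y"
proof (rule ccontr)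
  have cw: "continuous_on Y w" using w by (simp add: subsolutions_def)
  obtain u where u: "u \<in> A y" "\<forall>t\<in>A y. g y u + \<alpha> * w (f y u) \<le> g y t + \<alpha> * w (f y t)"
    using continuous_attains_inf[OF compact_A[OF y] A_nonempty[OF y]
        continuous_bellman_rhs_section[OF cw y]] by blast
  assume "\<not> ?thesis"
  then have "bellman y < g y u + \<alpha> * w (f y u)" using u by force
  then obtain c where c: "bellman y < c" "c < g y u + \<alpha> * w (f y u)" using dense by blast
  have "c < g y t + \<alpha> * w (f y t)" if "t \<in> A y" for t
    using c(2) u(2) that by force
  then obtain v where v: "continuous_on Y v" "v y = c"
    "\<And>z t. z \<in> Y \<Longrightarrow> t \<in> A z \<Longrightarrow> v z \<le> g z t + \<alpha> * w (f z t)"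
    using continuous_minorant[OF cw y, of c] by metis
  have "v z \<le> g z u + \<alpha> * max (v (f z u)) (w (f z u))" if "z \<in> Y" "u \<in> A z" for z u
  proof -
    have "\<alpha> * w (f z u) \<le> \<alpha> * max (v (f z u)) (w (f z u))" using alpha_pos by simp
    then show ?thesis using v(3)[OF that] by linarith
  qed
  then have "max (v y) (w y) \<le> bellman y"
    using subsolution_le_bellman[OF max_subsolution[OF v(1) _ w] y] by blast
  then show False using v(2) c(1) by simp
qed

text \<open>The control found in the previous lemma depends on \<open>w\<close>. The sets of good
  controls are closed and shrink as \<open>w\<close> grows, so directedness gives the finite
  intersection property, and compactness one control good for every \<open>w\<close>.\<close>

lemma bellman_ge:
  assumes y: "y \<in> Y"
  shows "\<exists>u\<in>A y. g y u + \<alpha> * bellman (f y u) \<le> bellman y"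
proof -
  define C where "C w = {u\<in>A y. g y u + \<alpha> * w (f y u) \<le> bellman y}" for w
  have "A y \<inter> (\<Inter>w\<in>subsolutions. C w) \<noteq> {}"
  proof (rule compact_imp_fip_image[OF compact_A[OF y]])
    fix w assume "w \<in> subsolutions"
    then have "continuous_on Y w" by (simp add: subsolutions_def)
    then show "closed (C w)"
      unfolding C_def
      by (intro continuous_on_closed_Collect_le continuous_bellman_rhs_section y
          continuous_on_const compact_imp_closed compact_A)
  next
    fix F assume F: "finite F" "F \<subseteq> subsolutions"
    then obtain w where w: "w \<in> subsolutions" "\<forall>v\<in>F. \<forall>y. v y \<le> w y"
      using subsolutions_finite_upper_bound by blast
    obtain u where u: "u \<in> A y" "g y u + \<alpha> * w (f y u) \<le> bellman y"
      using bellman_ge_subsolution_step[OF w(1) y] by blast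
    have "u \<in> C v" if "v \<in> F" for v
    proof -
      have "\<alpha> * v (f y u) \<le> \<alpha> * w (f y u)" using w that alpha_pos by simp
      then show ?thesis using u by (simp add: C_def)
    qed
    then show "A y \<inter> (\<Inter>w\<in>F. C w) \<noteq> {}" using u by blast
  qed
  then obtain u where u: "u \<in> A y" "\<And>w. w \<in> subsolutions \<Longrightarrow> g y u + \<alpha> * w (f y u) \<le> bellman y"
    by (auto simp: C_def)
  \<comment> \<open>Solving for \<open>w (f y u)\<close> gives a bound independent of
    \<open>w\<close>, which passes to the supremum.\<close>
  have "bellman (f y u) \<le> (bellman y - g y u) / \<alpha>"
    unfolding bellman_def[of "f y u"]
  proof (rule cSUP_least[OF subsolutions_nonempty])
    show "w (f y u) \<le> (bellman y - g y u) / \<alpha>" if "w \<in> subsolutions" for w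
      using u(2)[OF that] alpha_pos by (simp add: pos_le_divide_eq algebra_simps)
  qed
  then have "g y u + \<alpha> * bellman (f y u) \<le> bellman y"
    using alpha_pos by (simp add: pos_le_divide_eq algebra_simps)
  then show ?thesis using u(1) by blast
qed

text \<open>Let \<open>s\<close> be the supremum of \<open>\<psi> - bellman\<close>. Following a
  control optimal for \<open>bellman\<close> yields
  \<open>s \<le> \<alpha> * s + (1 - \<alpha>) * \<psi> y\<^sub>0 - m\<close>. Solving for
  \<open>m\<close> and using \<open>\<psi> y\<^sub>0 - s \<le> bellman y\<^sub>0\<close> gives the
  bound, which serves both optimisation problems.\<close>

lemma comparison:
  assumes \<psi>: "bdd_above (\<psi> ` Y)" and y0: "y\<^sub>0 \<in> Y"
    and m: "\<And>y u. y \<in> Y \<Longrightarrow> u \<in> A y \<Longrightarrow>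
      m \<le> g y u + \<alpha> * \<psi> (f y u) - \<psi> y + (1 - \<alpha>) * \<psi> y\<^sub>0"
  shows "m \<le> (1 - \<alpha>) * bellman y\<^sub>0"
proof -
  define s where "s = (SUP y\<in>Y. \<psi> y - bellman y)"
  obtain B where B: "\<And>y. y \<in> Y \<Longrightarrow> \<psi> y \<le> B" using \<psi> unfolding bdd_above_def by auto
  obtain C where C: "\<And>y. y \<in> Y \<Longrightarrow> \<bar>bellman y\<bar> \<le> C" using bounded_bellman unfolding bounded_iff by auto
  have bdd: "bdd_above ((\<lambda>y. \<psi> y - bellman y) ` Y)"
    using B C by (intro bdd_above.I2[of _ _ "B + C"]) (smt (verit))
  have le_s: "\<psi> y - bellman y \<le> s" if "y \<in> Y" for y
    unfolding s_def using that bdd by (rule cSUP_upper)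
  define r where "r = \<alpha> * s + (1 - \<alpha>) * \<psi> y\<^sub>0 - m"
  have "s \<le> r"
    unfolding s_def
  proof (rule cSUP_least)
    show "Y \<noteq> {}" using y0 by blast
    fix y assume y: "y \<in> Y"
    obtain u where u: "u \<in> A y" "g y u + \<alpha> * bellman (f y u) \<le> bellman y"
      using bellman_ge[OF y] by blast
    have "\<alpha> * (\<psi> (f y u) - bellman (f y u)) \<le> \<alpha> * s"
      using le_s[OF f_in[OF y u(1)]] alpha_pos by simp
    then show "\<psi> y - bellman y \<le> r"
      using m[OF y u(1)] u(2) by (simp add: r_def algebra_simps)
  qed
  then have "m \<le> (1 - \<alpha>) * (\<psi> y\<^sub>0 - s)" by (simp add: r_def algebra_simps)
  also have "\<dots> \<le> (1 - \<alpha>) * bellman y\<^sub>0"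
    using le_s[OF y0] alpha_less_1 by (intro mult_left_mono) auto
  finally show ?thesis .
qed

section \<open>Attained minima and the Hamiltonian\<close>

lemma lsc_attains_min:
  assumes \<psi>: "lsc_on Y \<psi>" and y: "y \<in> Y"
  shows "\<exists>u\<in>A y. \<forall>t\<in>A y. g y u + \<alpha> * (\<psi> (f y u) - c) \<le> g y t + \<alpha> * (\<psi> (f y t) - c)"
proof (rule closed_sublevels_attain_min[OF compact_A[OF y] A_nonempty[OF y]])
  fix a
  show "closed {u \<in> A y. g y u + \<alpha> * (\<psi> (f y u) - c) \<le> a}"
    unfolding closed_sequential_limits
  proof (intro allI impI, elim conjE)
    fix x l
    assume mem: "\<forall>n. x n \<in> {u \<in> A y. g y u + \<alpha> * (\<psi> (f y u) - c) \<le> a}" and lim: "x \<longlonglongrightarrow> l"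
    have x: "x n \<in> A y" "g y (x n) + \<alpha> * (\<psi> (f y (x n)) - c) \<le> a" for n
      using spec[OF mem, of n] by simp_all
    have l: "l \<in> A y"
      by (rule closed_sequentially[OF compact_imp_closed[OF compact_A[OF y]] x(1) lim])
    have limf: "(\<lambda>n. f y (x n)) \<longlonglongrightarrow> f y l" and limg: "(\<lambda>n. g y (x n)) \<longlonglongrightarrow> g y l"
      using continuous_on_tendsto_compose[OF continuous_on_section[OF continuous_f y] lim l]
        continuous_on_tendsto_compose[OF continuous_on_section[OF continuous_g y] lim l] x(1) by auto
    have "\<not> a < g y l + \<alpha> * (\<psi> (f y l) - c)"
    proof
      assume less: "a < g y l + \<alpha> * (\<psi> (f y l) - c)"
      \<comment> \<open>Half the gap: \<open>g\<close> may lose \<open>e\<close> and \<psi> may lose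
        \<open>e / \<alpha>\<close>, which costs another \<open>e\<close> after multiplication by
        \<alpha>. The value then still exceeds \<open>a\<close>.\<close>
      define e where "e = (g y l + \<alpha> * (\<psi> (f y l) - c) - a) / 2"
      have e: "e > 0" using less by (simp add: e_def)
      have "\<forall>\<^sub>F n in sequentially. \<psi> (f y l) - e / \<alpha> < \<psi> (f y (x n))"
        by (rule lsc_on_sequentially[OF \<psi> _ _ limf]) (use e alpha_pos f_in y x l in auto)
      moreover have "\<forall>\<^sub>F n in sequentially. g y l - e < g y (x n)"
        by (rule order_tendstoD[OF limg]) (use e in auto)
      ultimately have "\<forall>\<^sub>F n in sequentially. False"
      proof eventually_elim
        case (elim n)
        have "\<alpha> * (\<psi> (f y l) - e / \<alpha>) < \<alpha> * \<psi> (f y (x n))"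
          using elim(1) alpha_pos by (rule mult_strict_left_mono)
        then have "\<alpha> * \<psi> (f y l) - e < \<alpha> * \<psi> (f y (x n))"
          using alpha_pos by (simp add: right_diff_distrib)
        then show False using elim(2) x(2)[of n] by (simp add: e_def field_simps)
      qed
      then show False by simp
    qed
    then show "l \<in> {u \<in> A y. g y u + \<alpha> * (\<psi> (f y u) - c) \<le> a}" using l by simp
  qed
qed

lemma continuous_attains_min:
  assumes \<psi>: "continuous_on Y \<psi>" and y0: "y\<^sub>0 \<in> Y"
  shows "\<exists>p\<in>Sigma Y A. \<forall>q\<in>Sigma Y A.
    (\<lambda>(y, u). g y u + \<alpha> * (\<psi> (f y u) - \<psi> y) + (1 - \<alpha>) * (\<psi> y\<^sub>0 - \<psi> y)) p
      \<le> (\<lambda>(y, u). g y u + \<alpha> * (\<psi> (f y u) - \<psi> y) + (1 - \<alpha>) * (\<psi> y\<^sub>0 - \<psi> y)) q"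
proof (rule continuous_attains_inf[OF compact_graph])
  show "Sigma Y A \<noteq> {}" using A_nonempty[OF y0] y0 by blast
  show "continuous_on (Sigma Y A)
      (\<lambda>(y, u). g y u + \<alpha> * (\<psi> (f y u) - \<psi> y) + (1 - \<alpha>) * (\<psi> y\<^sub>0 - \<psi> y))"
    using continuous_g continuous_on_graph[OF \<psi>] continuous_on_graph_fst[OF \<psi>]
    by (auto simp: case_prod_unfold intro!: continuous_intros)
qed

text \<open>A \<open>LEAST\<close> over reals carries information only when attained, which lower
  semicontinuity of \<psi> guarantees. The equation for \<open>A\<close> ties the abstract map to
  the concrete definitions.\<close>

lemma hamiltonian_le:
  assumes A: "A = admissible Y U f" and "lsc_on Y \<psi>" "y \<in> Y" "u \<in> A y"
  shows "hamiltonian Y U f g \<alpha> \<psi> y \<le> g y u + \<alpha> * (\<psi> (f y u) - \<psi> y)"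
proof -
  obtain t where "t \<in> A y"
    "\<forall>s\<in>A y. g y t + \<alpha> * (\<psi> (f y t) - \<psi> y) \<le> g y s + \<alpha> * (\<psi> (f y s) - \<psi> y)"
    using lsc_attains_min[OF assms(2,3)] by blast
  then show ?thesis
    unfolding hamiltonian_def A[symmetric] using assms(4) by (subst Least_attained[of t]) auto
qed

lemma hamiltonian_ge:
  assumes A: "A = admissible Y U f" and "lsc_on Y \<psi>" "y \<in> Y"
    and m: "\<And>u. u \<in> A y \<Longrightarrow> m \<le> g y u + \<alpha> * (\<psi> (f y u) - \<psi> y)"
  shows "m \<le> hamiltonian Y U f g \<alpha> \<psi> y"
proof -
  obtain t where "t \<in> A y"
    "\<forall>s\<in>A y. g y t + \<alpha> * (\<psi> (f y t) - \<psi> y) \<le> g y s + \<alpha> * (\<psi> (f y s) - \<psi> y)"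
    using lsc_attains_min[OF assms(2,3)] by blast
  then show ?thesis
    unfolding hamiltonian_def A[symmetric] using m by (subst Least_attained[of t]) auto
qed

text \<open>The Bellman equation with \<open>\<alpha> * bellman y\<close> subtracted from both
  sides.\<close>

lemma hamiltonian_bellman:
  assumes A: "A = admissible Y U f" and y: "y \<in> Y"
  shows "hamiltonian Y U f g \<alpha> bellman y = (1 - \<alpha>) * bellman y"
proof (rule antisym)
  obtain u where u: "u \<in> A y" "g y u + \<alpha> * bellman (f y u) \<le> bellman y"
    using bellman_ge[OF y] by blast
  show "hamiltonian Y U f g \<alpha> bellman y \<le> (1 - \<alpha>) * bellman y"
    using hamiltonian_le[OF A lsc_bellman y u(1)] u(2) by (simp add: algebra_simps)
  show "(1 - \<alpha>) * bellman y \<le> hamiltonian Y U f g \<alpha> bellman y"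
    using bellman_le[OF y] by (intro hamiltonian_ge[OF A lsc_bellman y]) (simp add: algebra_simps)
qed

section \<open>The max-min value\<close>

lemma maxmin_value_eq:
  assumes A: "A = admissible Y U f" and y0: "y\<^sub>0 \<in> Y"
  shows "maxmin_value Y U f g \<alpha> y\<^sub>0 = (1 - \<alpha>) * bellman y\<^sub>0"
  unfolding maxmin_value_def
proof (rule Greatest_equality)
  \<comment> \<open>For \<open>\<psi> = bellman\<close> the terms in \<open>y\<close> cancel, so the
    infimum is over a constant.\<close>
  have "(INF y\<in>Y. hamiltonian Y U f g \<alpha> bellman y - (1 - \<alpha>) * (bellman y - bellman y\<^sub>0))
      = (INF y\<in>Y. (1 - \<alpha>) * bellman y\<^sub>0)"
    by (intro INF_cong refl) (simp add: hamiltonian_bellman[OF A] algebra_simps)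
  also have "\<dots> = (1 - \<alpha>) * bellman y\<^sub>0" using y0 by (intro cINF_const) auto
  finally show "(1 - \<alpha>) * bellman y\<^sub>0
      \<in> (\<lambda>\<psi>. INF y\<in>Y. hamiltonian Y U f g \<alpha> \<psi> y - (1 - \<alpha>) * (\<psi> y - \<psi> y\<^sub>0))
          ` {\<psi>. bounded (\<psi> ` Y) \<and> lsc_on Y \<psi>}"
    using bounded_bellman lsc_bellman by (intro image_eqI[of _ _ bellman]) auto
next
  fix v
  assume "v \<in> (\<lambda>\<psi>. INF y\<in>Y. hamiltonian Y U f g \<alpha> \<psi> y - (1 - \<alpha>) * (\<psi> y - \<psi> y\<^sub>0))
      ` {\<psi>. bounded (\<psi> ` Y) \<and> lsc_on Y \<psi>}"
  then obtain \<psi> where \<psi>: "bounded (\<psi> ` Y)" "lsc_on Y \<psi>"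
    and v: "v = (INF y\<in>Y. hamiltonian Y U f g \<alpha> \<psi> y - (1 - \<alpha>) * (\<psi> y - \<psi> y\<^sub>0))" by blast
  obtain M where M: "\<And>y u. y \<in> Y \<Longrightarrow> u \<in> A y \<Longrightarrow> \<bar>g y u\<bar> \<le> M" using g_bounded by blast
  obtain B where B: "\<And>y. y \<in> Y \<Longrightarrow> \<bar>\<psi> y\<bar> \<le> B" using \<psi>(1) unfolding bounded_iff by auto
  \<comment> \<open>A real \<open>INF\<close> lies below its members only if they are bounded below;
    this crude bound supplies that for \<open>cINF_lower\<close>.\<close>
  have lower: "- M - \<alpha> * (2 * B) - (1 - \<alpha>) * (2 * B)
      \<le> hamiltonian Y U f g \<alpha> \<psi> y - (1 - \<alpha>) * (\<psi> y - \<psi> y\<^sub>0)" if y: "y \<in> Y" for y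
  proof -
    have "- M - \<alpha> * (2 * B) \<le> hamiltonian Y U f g \<alpha> \<psi> y"
    proof (rule hamiltonian_ge[OF A \<psi>(2) y])
      fix u assume u: "u \<in> A y"
      have "- (2 * B) \<le> \<psi> (f y u) - \<psi> y" using B[OF y] B[OF f_in[OF y u]] by linarith
      then have "\<alpha> * (- (2 * B)) \<le> \<alpha> * (\<psi> (f y u) - \<psi> y)" using alpha_pos by (intro mult_left_mono) auto
      then show "- M - \<alpha> * (2 * B) \<le> g y u + \<alpha> * (\<psi> (f y u) - \<psi> y)" using M[OF y u] by simp
    qed
    moreover have "(1 - \<alpha>) * (\<psi> y - \<psi> y\<^sub>0) \<le> (1 - \<alpha>) * (2 * B)"
      using B[OF y] B[OF y0] alpha_less_1 by (intro mult_left_mono) auto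
    ultimately show ?thesis by linarith
  qed
  show "v \<le> (1 - \<alpha>) * bellman y\<^sub>0"
  proof (rule comparison[OF bounded_imp_bdd_above[OF \<psi>(1)] y0])
    fix y u assume yu: "y \<in> Y" "u \<in> A y"
    have "v \<le> hamiltonian Y U f g \<alpha> \<psi> y - (1 - \<alpha>) * (\<psi> y - \<psi> y\<^sub>0)"
      unfolding v by (rule cINF_lower[OF bdd_below.I2[OF lower] yu(1)])
    also have "\<dots> \<le> g y u + \<alpha> * (\<psi> (f y u) - \<psi> y) - (1 - \<alpha>) * (\<psi> y - \<psi> y\<^sub>0)"
      using hamiltonian_le[OF A \<psi>(2) yu] by simp
    also have "\<dots> = g y u + \<alpha> * \<psi> (f y u) - \<psi> y + (1 - \<alpha>) * \<psi> y\<^sub>0"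
      by (simp add: algebra_simps)
    finally show "v \<le> g y u + \<alpha> * \<psi> (f y u) - \<psi> y + (1 - \<alpha>) * \<psi> y\<^sub>0" .
  qed
qed

section \<open>Convergence of the approximating values\<close>

lemma approx_value_tendsto:
  assumes A: "A = admissible Y U f" and y0: "y\<^sub>0 \<in> Y"
    and cont: "\<And>i. i \<ge> 1 \<Longrightarrow> continuous_on Y (\<phi> i)"
    and dense: "\<And>\<psi> \<delta>. \<lbrakk>continuous_on Y \<psi>; 0 < \<delta>\<rbrakk> \<Longrightarrow>
      \<exists>N c. \<forall>y\<in>Y. \<bar>\<psi> y - (\<Sum>i=1..N. c i * \<phi> i y)\<bar> \<le> \<delta>"
  shows "(\<lambda>N. approx_value Y U f g \<alpha> \<phi> N y\<^sub>0) \<longlonglongrightarrow> (1 - \<alpha>) * bellman y\<^sub>0"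
proof -
  define obj where "obj \<psi> = (\<lambda>(y, u). g y u + \<alpha> * (\<psi> (f y u) - \<psi> y) + (1 - \<alpha>) * (\<psi> y\<^sub>0 - \<psi> y))"
    for \<psi>
  define val where "val \<psi> = (LEAST v. v \<in> obj \<psi> ` Sigma Y A)" for \<psi>
  have approx: "approx_value Y U f g \<alpha> \<phi> N y\<^sub>0 = (SUP \<psi>\<in>linear_combinations \<phi> N. val \<psi>)" for N
    by (simp add: approx_value_def val_def obj_def admissible_graph_eq A)
  have contD: "continuous_on Y \<psi>" if "\<psi> \<in> linear_combinations \<phi> N" for \<psi> N
    using that cont by (auto simp: linear_combinations_def intro!: continuous_intros)
  have val: "\<exists>p\<in>Sigma Y A. val \<psi> = obj \<psi> p \<and> (\<forall>q\<in>Sigma Y A. obj \<psi> p \<le> obj \<psi> q)"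
    if \<psi>: "continuous_on Y \<psi>" for \<psi>
  proof -
    obtain p where "p \<in> Sigma Y A" "\<forall>q\<in>Sigma Y A. obj \<psi> p \<le> obj \<psi> q"
      using continuous_attains_min[OF \<psi> y0] unfolding obj_def by blast
    then show ?thesis
      unfolding val_def using Least_attained[of p "Sigma Y A" "obj \<psi>"] by blast
  qed
  have val_le: "val \<psi> \<le> (1 - \<alpha>) * bellman y\<^sub>0" if \<psi>: "continuous_on Y \<psi>" for \<psi>
  proof (rule comparison[OF _ y0])
    show "bdd_above (\<psi> ` Y)"
      by (intro bounded_imp_bdd_above compact_imp_bounded compact_continuous_image \<psi> compact_Y)
    fix y u assume "y \<in> Y" "u \<in> A y"
    then have "val \<psi> \<le> obj \<psi> (y, u)" using val[OF \<psi>] by auto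
    then show "val \<psi> \<le> g y u + \<alpha> * \<psi> (f y u) - \<psi> y + (1 - \<alpha>) * \<psi> y\<^sub>0"
      by (simp add: obj_def algebra_simps)
  qed
  have D_nonempty: "linear_combinations \<phi> N \<noteq> {}" for N
    by (auto simp: linear_combinations_def)
  have upper: "approx_value Y U f g \<alpha> \<phi> N y\<^sub>0 \<le> (1 - \<alpha>) * bellman y\<^sub>0" for N
    unfolding approx using val_le contD by (intro cSUP_least D_nonempty) blast
  \<comment> \<open>The comparison bound also makes the set of values bounded above, as the real
    \<open>SUP\<close> requires.\<close>
  have val_le_approx: "val \<psi> \<le> approx_value Y U f g \<alpha> \<phi> N y\<^sub>0"
    if "\<psi> \<in> linear_combinations \<phi> N" for \<psi> N
    unfolding approx
    by (rule cSUP_upper[OF that bdd_above.I2]) (use val_le contD in blast)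
  show ?thesis
  proof (rule order_tendstoI)
    fix a assume "(1 - \<alpha>) * bellman y\<^sub>0 < a"
    then show "\<forall>\<^sub>F N in sequentially. approx_value Y U f g \<alpha> \<phi> N y\<^sub>0 < a"
      using upper by (intro always_eventually) (metis order_le_less_trans)
  next
    fix a assume "a < (1 - \<alpha>) * bellman y\<^sub>0"
    then have "a / (1 - \<alpha>) < bellman y\<^sub>0"
      using alpha_less_1 by (simp add: pos_divide_less_eq mult.commute)
    then obtain w where w: "w \<in> subsolutions" "a / (1 - \<alpha>) < w y\<^sub>0" using less_bellmanD y0 by blast
    \<comment> \<open>The target \<open>a\<close> lies \<open>4 * \<delta>\<close> below
      \<open>(1 - \<alpha>) * w y\<^sub>0\<close>. Replacing \<open>w\<close> by \<psi> costs at
      most \<open>\<alpha> * \<delta>\<close> at the successor, \<delta> at \<open>y\<close> and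
      \<open>(1 - \<alpha>) * \<delta>\<close> at \<open>y\<^sub>0\<close>, in total
      \<open>2 * \<delta>\<close>.\<close>
    define \<delta> where "\<delta> = ((1 - \<alpha>) * w y\<^sub>0 - a) / 4"
    have \<delta>: "0 < \<delta>"
      using w(2) alpha_less_1 by (simp add: \<delta>_def pos_divide_less_eq mult.commute)
    obtain N c where Nc: "\<forall>y\<in>Y. \<bar>w y - (\<Sum>i=1..N. c i * \<phi> i y)\<bar> \<le> \<delta>"
      using dense[OF _ \<delta>] w(1) unfolding subsolutions_def by blast
    define \<psi> where "\<psi> y = (\<Sum>i=1..N. c i * \<phi> i y)" for y
    have near: "\<bar>w y - \<psi> y\<bar> \<le> \<delta>" if "y \<in> Y" for y using Nc that by (simp add: \<psi>_def)
    have \<psi>: "\<psi> \<in> linear_combinations \<phi> N" unfolding linear_combinations_def \<psi>_def by blast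
    obtain y u where yu: "y \<in> Y" "u \<in> A y" and v: "val \<psi> = obj \<psi> (y, u)"
      using val[OF contD[OF \<psi>]] by auto
    have "\<alpha> * (w (f y u) - \<psi> (f y u)) \<le> \<alpha> * \<delta>" "(1 - \<alpha>) * (w y\<^sub>0 - \<psi> y\<^sub>0) \<le> (1 - \<alpha>) * \<delta>"
      using near[OF f_in[OF yu]] near[OF y0] alpha_pos alpha_less_1
      by (intro mult_left_mono; simp)+
    moreover have "\<psi> y - w y \<le> \<delta>" using near[OF yu(1)] by linarith
    moreover have "w y \<le> g y u + \<alpha> * w (f y u)" using w(1) yu by (simp add: subsolutions_def)
    ultimately have "(1 - \<alpha>) * w y\<^sub>0 - 2 * \<delta> \<le> val \<psi>"
      unfolding v obj_def by (simp add: algebra_simps)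
    then have "a < val \<psi>" using \<delta> unfolding \<delta>_def by argo
    then have "a < approx_value Y U f g \<alpha> \<phi> N' y\<^sub>0" if "N \<le> N'" for N'
      using val_le_approx[of \<psi> N'] \<psi> linear_combinations_mono[OF that] by force
    then show "\<forall>\<^sub>F N in sequentially. a < approx_value Y U f g \<alpha> \<phi> N y\<^sub>0"
      by (rule eventually_sequentiallyI)
  qed
qed

end

section \<open>Application to the original data\<close>

theorem proposition4:
  fixes Y :: "(real ^ 'm) set"
    and U\<^sub>0 :: "'u::metric_space set"
    and U :: "real ^ 'm \<Rightarrow> 'u set"
    and f :: "real ^ 'm \<Rightarrow> 'u \<Rightarrow> real ^ 'm"
    and g :: "real ^ 'm \<Rightarrow> 'u \<Rightarrow> real"
    and \<alpha> :: real
    and \<phi> :: "nat \<Rightarrow> real ^ 'm \<Rightarrow> real"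
    and y\<^sub>0 :: "real ^ 'm"
  assumes "Y \<noteq> {}" and "compact Y"
    and "compact U\<^sub>0"
    and "\<And>y. y \<in> Y \<Longrightarrow> U y \<subseteq> U\<^sub>0"
    and "\<And>y. y \<in> Y \<Longrightarrow> compact (U y)"
    and "usc_set_valued_on Y U"
    and "continuous_on (UNIV \<times> U\<^sub>0) (\<lambda>(y, u). f y u)"
    and "continuous_on (UNIV \<times> U\<^sub>0) (\<lambda>(y, u). g y u)"
    and "0 < \<alpha>" and "\<alpha> < 1"
    and "\<And>y. y \<in> Y \<Longrightarrow> admissible Y U f y \<noteq> {}"
    and "\<And>i. i \<ge> 1 \<Longrightarrow> continuous_on Y (\<phi> i)"
    and "\<And>y. y \<in> Y \<Longrightarrow> \<phi> 1 y = 1"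
    and "\<And>S I. \<lbrakk>open S; S \<noteq> {}; S \<subseteq> Y; finite I; I \<subseteq> {1..}\<rbrakk> \<Longrightarrow> linearly_independent_on S I \<phi>"
    and "\<And>\<psi> \<delta>. \<lbrakk>continuous_on Y \<psi>; 0 < \<delta>\<rbrakk> \<Longrightarrow>
           \<exists>N c. \<forall>y\<in>Y. \<bar>\<psi> y - (\<Sum>i=1..N. c i * \<phi> i y)\<bar> \<le> \<delta>"
    and "y\<^sub>0 \<in> Y"
  shows "(\<lambda>N. approx_value Y U f g \<alpha> \<phi> N y\<^sub>0) \<longlonglongrightarrow> maxmin_value Y U f g \<alpha> y\<^sub>0"
proof -
  \<comment> \<open>The graph lies where \<open>f\<close> and \<open>g\<close> are assumed
    continuous, so their continuity restricts to it.\<close>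
  have sub: "Sigma Y (admissible Y U f) \<subseteq> UNIV \<times> U\<^sub>0"
    using assms(4) by (fastforce simp: admissible_def)
  interpret discounted_control Y "admissible Y U f" f g \<alpha>
  proof
    show "compact (Sigma Y (admissible Y U f))"
      unfolding admissible_graph_eq[symmetric]
      using assms(2-6) continuous_on_subset[OF assms(7), of "Y \<times> U\<^sub>0"]
      by (intro compact_admissible_graph) auto
    show "continuous_on (Sigma Y (admissible Y U f)) (\<lambda>(y, u). f y u)"
      "continuous_on (Sigma Y (admissible Y U f)) (\<lambda>(y, u). g y u)"
      using assms(7,8) sub by (auto intro: continuous_on_subset)
  qed (use assms(9-11) in \<open>auto simp: admissible_def\<close>)
  show ?thesis
    unfolding maxmin_value_eq[OF refl \<open>y\<^sub>0 \<in> Y\<close>]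
    using approx_value_tendsto[OF refl \<open>y\<^sub>0 \<in> Y\<close> assms(12,15)] by blast
qed

end
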